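(* Let $\lambda = (\lambda_1, \lambda_2, \dots, \lambda_k)$ be a partition. Then the elementary symmetric function $e_\lambda$ satisfies $$e_\lambda = \frac{1}{(\lambda_1)^2 (\lambda_2)^2 \cdots (\lambda_k)^2}\, X_{K_{\lambda_1}}^{K_{\lambda_1}} X_{K_{\lambda_2}}^{K_{\lambda_2}} \cdots X_{K_{\lambda_k}}^{K_{\lambda_k}} .$$
   Context: All graphs are finite, simple and undirected. $K_n$ is the complete graph on $n$ vertices. $m_\lambda$ denotes the monomial symmetric function indexed by the partition $\lambda$, $e_n=m_{(1^n)}=\sum_{i_1<\cdots<i_n}x_{i_1}\cdots x_{i_n}$, and $e_\lambda=e_{\lambda_1}e_{\lambda_2}\cdots e_{\lambda_k}$. $H$-chromatic symmetric function: let $G,H$ be graphs with $|V(G)|=d$, $|V(H)|=N$. A labeling of $H$ is here a bijection $\phi:V(H)\to[N]=\{1,\dots,N\}$. A proper $(H,\phi)$-coloring of $G$ is a map $\kappa:V(G)\to[N]$ such that whenever $u,v$ are adjacent in $G$, $\phi^{-1}(\kappa(u))$ and $\phi^{-1}(\kappa(v))$ are adjacent in $H$. Put $w_G^H=\sum_\phi\sum_\kappa\prod_{v\in V(G)}x_{\kappa(v)}$, summed over all labelings $\phi$ and all proper $(H,\phi)$-colorings $\kappa$. This is a symmetric polynomial in $x_1,\dots,x_N$, homogeneous of degree $d$; writing $w_G^H=\sum_{\mu\vdash d,\,l(\mu)\le N}c_\mu m_\mu(x_1,\dots,x_N)$ (with $l(\mu)$ the number of parts of $\mu$), define $X_G^H=\sum_{\mu\vdash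 d,\,l(\mu)\le N}c_\mu m_\mu$, a homogeneous symmetric function of degree $d$ in infinitely many variables.
   Formalization: The normalising factor is corrected from 1/∏(λ_i)² to 1/∏(λ_i!)²; as printed the identity fails, e.g. for λ=(3), where X_{K_3}^{K_3}=36 e_3 rather than 9 e_3 (the two agree when all parts are at most 2). *)

theory Defs
  imports
    "HOL-Library.Poly_Mapping"
    "HOL-Library.FuncSet"
    "HOL-Library.Multiset"
    "HOL-Combinatorics.Permutations"
    "Graph_Theory.Kuratowski"
begin

section \<open>Formal power series in countably many variables\<close>

text \<open>
  Variables are indexed by \<^typ>\<open>nat\<close> starting from 0, so the informal $x_1, x_2, \ldots$ are
  $x_0, x_1, \ldots$ here, and the colour set $[N]$ is \<open>{..<N}\<close>. A monomial is its finitely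
  supported exponent vector. Symmetric functions are elements of this ring; the polynomial ring
  is the library type \<open>(nat \<Rightarrow>\<^sub>0 nat) \<Rightarrow>\<^sub>0 'a\<close>.
\<close>

typedef 'a mseries = "UNIV :: ((nat \<Rightarrow>\<^sub>0 nat) \<Rightarrow> 'a) set"
  morphisms mcoeff Abs_mseries ..

setup_lifting type_definition_mseries

lemma mseries_eqI: "(\<And>a. mcoeff f a = mcoeff g a) \<Longrightarrow> f = g"
  by transfer auto

definition splits :: "(nat \<Rightarrow>\<^sub>0 nat) \<Rightarrow> ((nat \<Rightarrow>\<^sub>0 nat) \<times> (nat \<Rightarrow>\<^sub>0 nat)) set"
  where "splits a = {(b, c). b + c = a}"

lemma finite_splits [simp]: "finite (splits a)"
proof -
  let ?F = "\<lambda>b :: nat \<Rightarrow>\<^sub>0 nat. restrict (Poly_Mapping.lookup b) (Poly_Mapping.keys a)"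
  let ?B = "{b. \<exists>c. b + c = a}"
  have le: "Poly_Mapping.lookup b i \<le> Poly_Mapping.lookup a i" if "b \<in> ?B" for b i
    using that by (auto simp: lookup_add)
  have "finite (PiE (Poly_Mapping.keys a) (\<lambda>i. {..Poly_Mapping.lookup a i}))"
    by (intro finite_PiE) auto
  moreover have "?F ` ?B \<subseteq> PiE (Poly_Mapping.keys a) (\<lambda>i. {..Poly_Mapping.lookup a i})"
    using le by auto
  ultimately have "finite (?F ` ?B)" by (rule finite_subset[rotated])
  moreover have "inj_on ?F ?B"
  proof (rule inj_onI)
    fix b b' assume b: "b \<in> ?B" "b' \<in> ?B" and eq: "?F b = ?F b'"
    show "b = b'"
    proof (rule poly_mapping_eqI)
      fix i show "Poly_Mapping.lookup b i = Poly_Mapping.lookup b' i"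
      proof (cases "i \<in> Poly_Mapping.keys a")
        case True then show ?thesis using fun_cong[OF eq, of i] by simp
      next
        case False
        then have "Poly_Mapping.lookup a i = 0" by (simp add: in_keys_iff)
        then show ?thesis using le[OF b(1), of i] le[OF b(2), of i] by simp
      qed
    qed
  qed
  ultimately have "finite ?B" by (rule finite_imageD)
  moreover have "splits a \<subseteq> (\<lambda>b. (b, a - b)) ` ?B"
    by (auto simp: splits_def)
  ultimately show ?thesis by (meson finite_imageI finite_subset)
qed

instantiation mseries :: (comm_ring_1) comm_ring_1
begin

lift_definition zero_mseries :: "'a mseries" is "\<lambda>_. 0" .
lift_definition one_mseries :: "'a mseries" is "\<lambda>a. if a = 0 then 1 else 0" .
lift_definition plus_mseries :: "'a mseries \<Rightarrow> 'a mseries \<Rightarrow> 'a mseries"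
  is "\<lambda>f g a. f a + g a" .
lift_definition minus_mseries :: "'a mseries \<Rightarrow> 'a mseries \<Rightarrow> 'a mseries"
  is "\<lambda>f g a. f a - g a" .
lift_definition uminus_mseries :: "'a mseries \<Rightarrow> 'a mseries"
  is "\<lambda>f a. - f a" .
lift_definition times_mseries :: "'a mseries \<Rightarrow> 'a mseries \<Rightarrow> 'a mseries"
  is "\<lambda>f g a. \<Sum>(b, c)\<in>splits a. f b * g c" .

instance
proof
  fix f g h :: "'a mseries"
  show "f * g * h = f * (g * h)"
  proof (transfer, rule ext)
    fix f g h :: "(nat \<Rightarrow>\<^sub>0 nat) \<Rightarrow> 'a" and a
    have "(\<Sum>(p, e)\<in>splits a. (\<Sum>(b, c)\<in>splits p. f b * g c) * h e) =
          (\<Sum>x\<in>(SIGMA q:splits a. splits (fst q)).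
              f (fst (snd x)) * g (snd (snd x)) * h (snd (fst x)))"
      by (simp add: sum_distrib_right sum.Sigma case_prod_unfold)
    also have "\<dots> = (\<Sum>x\<in>(SIGMA q:splits a. splits (snd q)).
              f (fst (fst x)) * g (fst (snd x)) * h (snd (snd x)))"
      by (rule sum.reindex_bij_witness[of _
            "\<lambda>((b, p), (c, e)). ((b + c, e), (b, c))"
            "\<lambda>((p, e), (b, c)). ((b, c + e), (c, e))"])
         (auto simp: splits_def add.assoc)
    also have "\<dots> = (\<Sum>(b, p)\<in>splits a. f b * (\<Sum>(c, e)\<in>splits p. g c * h e))"
      by (simp add: sum_distrib_left sum.Sigma case_prod_unfold mult.assoc)
    finally show "(\<Sum>(p, e)\<in>splits a. (\<Sum>(b, c)\<in>splits p. f b * g c) * h e) =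
      (\<Sum>(b, p)\<in>splits a. f b * (\<Sum>(c, e)\<in>splits p. g c * h e))" .
  qed
  show "f * g = g * f"
  proof (transfer, rule ext)
    fix f g :: "(nat \<Rightarrow>\<^sub>0 nat) \<Rightarrow> 'a" and a
    show "(\<Sum>(b, c)\<in>splits a. f b * g c) = (\<Sum>(b, c)\<in>splits a. g b * f c)"
      by (rule sum.reindex_bij_witness[of _ prod.swap prod.swap])
         (auto simp: splits_def add.commute mult.commute)
  qed
  show "1 * f = f"
  proof (transfer, rule ext)
    fix f :: "(nat \<Rightarrow>\<^sub>0 nat) \<Rightarrow> 'a" and a
    have "(\<Sum>(b, c)\<in>splits a. (if b = 0 then 1 else 0) * f c) =
          (\<Sum>(b, c)\<in>{(0 :: nat \<Rightarrow>\<^sub>0 nat, a)}. (if b = 0 then 1 else 0) * f c)"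
      by (rule sum.mono_neutral_right) (simp, auto simp: splits_def split: if_splits)
    then show "(\<Sum>(b, c)\<in>splits a. (if b = 0 then 1 else 0) * f c) = f a" by simp
  qed
  show "(f + g) * h = f * h + g * h"
    by transfer (auto simp: fun_eq_iff case_prod_unfold distrib_right sum.distrib)
  show "f + g + h = f + (g + h)" by transfer (simp add: add.assoc)
  show "f + g = g + f" by transfer (simp add: add.commute)
  show "0 + f = f" by transfer simp
  show "- f + f = 0" by transfer simp
  show "f - g = f + - g" by transfer simp
  show "(0 :: 'a mseries) \<noteq> 1"
    by transfer (metis (mono_tags) zero_neq_one)
qed

end

lift_definition mscale :: "'a :: comm_ring_1 \<Rightarrow> 'a mseries \<Rightarrow> 'a mseries"
  is "\<lambda>k f a. k * f a" .

lemma mcoeff_sum: "mcoeff (\<Sum>x\<in>A. f x) a = (\<Sum>x\<in>A. mcoeff (f x) a)"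
  by (induction A rule: infinite_finite_induct)
     (auto simp: zero_mseries.rep_eq plus_mseries.rep_eq)

section \<open>Partitions, monomial and elementary symmetric functions\<close>

definition is_partition :: "nat list \<Rightarrow> bool"
  where "is_partition mu \<longleftrightarrow> sorted_wrt (\<ge>) mu \<and> 0 \<notin> set mu"

definition partitions_of :: "nat \<Rightarrow> nat \<Rightarrow> nat list set"
  where "partitions_of d N = {mu. is_partition mu \<and> sum_list mu = d \<and> length mu \<le> N}"

definition shape :: "(nat \<Rightarrow>\<^sub>0 nat) \<Rightarrow> nat multiset"
  where "shape a = image_mset (Poly_Mapping.lookup a) (mset_set (Poly_Mapping.keys a))"

text \<open>$m_\mu$ is the sum of all distinct monomials whose multiset of nonzero exponents is $\mu$.\<close>

lift_definition msym :: "nat list \<Rightarrow> rat mseries"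
  is "\<lambda>mu a. if shape a = mset mu then 1 else 0" .

definition msym_poly :: "nat \<Rightarrow> nat list \<Rightarrow> (nat \<Rightarrow>\<^sub>0 nat) \<Rightarrow>\<^sub>0 rat"
  where "msym_poly N mu =
    (\<Sum>a | shape a = mset mu \<and> Poly_Mapping.keys a \<subseteq> {..<N}. Poly_Mapping.single a 1)"

definition esym :: "nat \<Rightarrow> rat mseries"
  where "esym n = msym (replicate n 1)"

definition esym_part :: "nat list \<Rightarrow> rat mseries"
  where "esym_part lam = (\<Prod>n\<leftarrow>lam. esym n)"

section \<open>The H-chromatic symmetric function\<close>

definition labelings :: "('b, 'd) pre_digraph \<Rightarrow> ('b \<Rightarrow> nat) set"
  where "labelings H =
    {\<phi> \<in> verts H \<rightarrow>\<^sub>E {..<card (verts H)}. bij_betw \<phi> (verts H) {..<card (verts H)}}"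

definition proper_colorings ::
    "('a, 'c) pre_digraph \<Rightarrow> ('b, 'd) pre_digraph \<Rightarrow> ('b \<Rightarrow> nat) \<Rightarrow> ('a \<Rightarrow> nat) set"
  where "proper_colorings G H \<phi> =
    {\<kappa> \<in> verts G \<rightarrow>\<^sub>E {..<card (verts H)}. \<forall>u v. u \<rightarrow>\<^bsub>G\<^esub> v \<longrightarrow>
       inv_into (verts H) \<phi> (\<kappa> u) \<rightarrow>\<^bsub>H\<^esub> inv_into (verts H) \<phi> (\<kappa> v)}"

definition pvar :: "nat \<Rightarrow> (nat \<Rightarrow>\<^sub>0 nat) \<Rightarrow>\<^sub>0 rat"
  where "pvar i = Poly_Mapping.single (Poly_Mapping.single i 1) 1"

definition w_poly ::
    "('a, 'c) pre_digraph \<Rightarrow> ('b, 'd) pre_digraph \<Rightarrow> (nat \<Rightarrow>\<^sub>0 nat) \<Rightarrow>\<^sub>0 rat"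
  where "w_poly G H = (\<Sum>\<phi>\<in>labelings H. \<Sum>\<kappa>\<in>proper_colorings G H \<phi>. \<Prod>v\<in>verts G. pvar (\<kappa> v))"

text \<open>
  $c_\mu$ is the coefficient of $x^\mu$ in $w_G^H$. Lemmas \<open>w_poly_expansion\<close> and
  \<open>w_poly_expansion_unique\<close> below show that these are exactly the coefficients of the
  expansion of $w_G^H$ in the $m_\mu(x_1, \ldots, x_N)$.
\<close>

definition w_coeff :: "('a, 'c) pre_digraph \<Rightarrow> ('b, 'd) pre_digraph \<Rightarrow> nat list \<Rightarrow> rat"
  where "w_coeff G H mu = Poly_Mapping.lookup (w_poly G H) (Poly_Mapping.nth mu)"

definition X_sym :: "('a, 'c) pre_digraph \<Rightarrow> ('b, 'd) pre_digraph \<Rightarrow> rat mseries"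
  where "X_sym G H =
    (\<Sum>mu\<in>partitions_of (card (verts G)) (card (verts H)). mscale (w_coeff G H mu) (msym mu))"

text \<open>
  For $G = H = K_n$ there are $n!$ labelings, each admitting $n!$ proper colorings, and every
  coloring contributes $x_1 \cdots x_n$. Hence $X_{K_n}^{K_n} = (n!)^2 e_n$, so the scalar that
  normalises a product of such functions is built from squares of factorials, not from $n^2$.
\<close>

section \<open>Well-definedness of the expansion\<close>

lemma finite_partitions_of [simp]: "finite (partitions_of d N)"
proof (rule finite_subset)
  show "partitions_of d N \<subseteq> {xs. set xs \<subseteq> {..d} \<and> length xs \<le> N}"
    by (auto simp: partitions_of_def dest: member_le_sum_list)
  show "finite {xs. set xs \<subseteq> {..d} \<and> length xs \<le> N}"
    by (rule finite_lists_length_le) simp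
qed

lemma partition_mset_inj:
  assumes "is_partition mu" "is_partition nu" "mset mu = mset nu"
  shows "mu = nu"
proof -
  have "sorted (rev mu)" "sorted (rev nu)"
    using assms(1,2) by (auto simp: is_partition_def sorted_wrt_rev)
  then have "rev mu = rev nu"
    using assms(3) by (metis mset_rev properties_for_sort)
  then show ?thesis by simp
qed

lemma shape_nth:
  assumes "0 \<notin> set mu"
  shows "shape (Poly_Mapping.nth mu) = mset mu" "Poly_Mapping.keys (Poly_Mapping.nth mu) = {..<length mu}"
proof -
  show k: "Poly_Mapping.keys (Poly_Mapping.nth mu) = {..<length mu}"
    using assms by (auto simp: in_keys_iff nth_default_def simp del: keys_nth split: if_splits dest: nth_mem)
      (metis gr0I nth_mem)
  have "mset mu = image_mset ((!) mu) (mset_set {..<length mu})"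
    by (metis map_nth mset_map mset_upt lessThan_atLeast0)
  also have "\<dots> = shape (Poly_Mapping.nth mu)"
    unfolding shape_def k by (intro image_mset_cong) (auto simp: nth_default_def)
  finally show "shape (Poly_Mapping.nth mu) = mset mu" ..
qed

lemma finite_shape:
  "finite {a. shape a = M \<and> Poly_Mapping.keys a \<subseteq> {..<N}}"
proof -
  let ?A = "{a. shape a = M \<and> Poly_Mapping.keys a \<subseteq> {..<N}}"
  let ?F = "\<lambda>b :: nat \<Rightarrow>\<^sub>0 nat. restrict (Poly_Mapping.lookup b) {..<N}"
  have "finite (PiE {..<N} (\<lambda>_. insert 0 (set_mset M)))"
    by (intro finite_PiE) auto
  moreover have "Poly_Mapping.lookup a i \<in> insert 0 (set_mset M)" if "a \<in> ?A" for a i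
    using that by (cases "i \<in> Poly_Mapping.keys a") (auto simp: shape_def in_keys_iff)
  then have "?F ` ?A \<subseteq> PiE {..<N} (\<lambda>_. insert 0 (set_mset M))"
    by (intro image_subsetI restrict_PiE_iff[THEN iffD2]) blast
  ultimately have "finite (?F ` ?A)" by (rule finite_subset[rotated])
  moreover have "inj_on ?F ?A"
  proof (rule inj_onI)
    fix b b' assume b: "b \<in> ?A" "b' \<in> ?A" and eq: "?F b = ?F b'"
    show "b = b'"
    proof (rule poly_mapping_eqI)
      fix i show "Poly_Mapping.lookup b i = Poly_Mapping.lookup b' i"
      proof (cases "i < N")
        case True then show ?thesis using fun_cong[OF eq, of i] by simp
      next
        case False
        then have "i \<notin> Poly_Mapping.keys b" "i \<notin> Poly_Mapping.keys b'" using b by auto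
        then show ?thesis by (simp add: in_keys_iff)
      qed
    qed
  qed
  ultimately show ?thesis by (rule finite_imageD)
qed

lemma lookup_sum': "Poly_Mapping.lookup (\<Sum>x\<in>A. f x) a = (\<Sum>x\<in>A. Poly_Mapping.lookup (f x) a)"
  by (induction A rule: infinite_finite_induct) (auto simp: lookup_add)

lemma lookup_msym_poly:
  "Poly_Mapping.lookup (msym_poly N mu) a = (if shape a = mset mu \<and> Poly_Mapping.keys a \<subseteq> {..<N} then 1 else 0)"
  by (simp add: msym_poly_def lookup_sum' lookup_single when_def finite_shape sum.delta)

lemma lookup_const_mult:
  "Poly_Mapping.lookup (Poly_Mapping.single 0 k * p) a = k * Poly_Mapping.lookup p (a :: nat \<Rightarrow>\<^sub>0 nat)"
  for k :: rat
  by (simp add: Poly_Mapping.map.rep_eq when_def flip: mult_map_scale_conv_mult)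

definition content :: "'a set \<Rightarrow> ('a \<Rightarrow> nat) \<Rightarrow> nat \<Rightarrow>\<^sub>0 nat"
  where "content V \<kappa> = (\<Sum>v\<in>V. Poly_Mapping.single (\<kappa> v) 1)"

lemma lookup_content:
  "finite V \<Longrightarrow> Poly_Mapping.lookup (content V \<kappa>) i = card {v \<in> V. \<kappa> v = i}"
  by (simp add: content_def lookup_sum' lookup_single when_def sum.If_cases Int_def)

lemma prod_pvar:
  "finite V \<Longrightarrow> (\<Prod>v\<in>V. pvar (\<kappa> v)) = Poly_Mapping.single (content V \<kappa>) 1"
  by (induction V rule: finite_induct) (auto simp: content_def pvar_def mult_single)

lemma finite_labelings: "finite (verts H) \<Longrightarrow> finite (labelings H)"
  by (rule finite_subset[of _ "verts H \<rightarrow>\<^sub>E {..<card (verts H)}"])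
     (auto simp: labelings_def intro!: finite_PiE)

lemma finite_proper_colorings: "finite (verts G) \<Longrightarrow> finite (proper_colorings G H \<phi>)"
  by (rule finite_subset[of _ "verts G \<rightarrow>\<^sub>E {..<card (verts H)}"])
     (auto simp: proper_colorings_def intro!: finite_PiE)

lemma lookup_w_poly:
  assumes "finite (verts G)" "finite (verts H)"
  shows "Poly_Mapping.lookup (w_poly G H) a = (\<Sum>(\<phi>, \<kappa>)\<in>Sigma (labelings H) (proper_colorings G H).
           if content (verts G) \<kappa> = a then 1 else 0)"
  using assms
  by (simp add: w_poly_def prod_pvar lookup_sum' lookup_single when_def sum.Sigma case_prod_unfold
      finite_labelings finite_proper_colorings)

lemma w_poly_permute:
  assumes fin: "finite (verts G)" "finite (verts H)"
    and wf: "wf_digraph G"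
    and p: "p permutes {..<card (verts H)}"
    and ab: "\<And>i. Poly_Mapping.lookup b (p i) = Poly_Mapping.lookup a i"
  shows "Poly_Mapping.lookup (w_poly G H) a = Poly_Mapping.lookup (w_poly G H) b"
proof -
  let ?N = "card (verts H)"
  let ?S = "Sigma (labelings H) (proper_colorings G H)"
  let ?T = "\<lambda>q. \<lambda>(\<phi>, \<kappa>). (restrict (q \<circ> \<phi>) (verts H), restrict (q \<circ> \<kappa>) (verts G))"
  have mem: "?T q x \<in> ?S" if q: "q permutes {..<?N}" and x: "x \<in> ?S" for q x
  proof -
    obtain \<phi> \<kappa> where xe: "x = (\<phi>, \<kappa>)" by (cases x)
    have phi: "bij_betw \<phi> (verts H) {..<?N}"
      and kap: "\<kappa> \<in> verts G \<rightarrow>\<^sub>E {..<?N}"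
      and ad: "\<And>u v. u \<rightarrow>\<^bsub>G\<^esub> v \<Longrightarrow>
        inv_into (verts H) \<phi> (\<kappa> u) \<rightarrow>\<^bsub>H\<^esub> inv_into (verts H) \<phi> (\<kappa> v)"
      using x xe by (auto simp: labelings_def proper_colorings_def)
    have bq: "bij_betw q {..<?N} {..<?N}" using q by (rule permutes_imp_bij)
    let ?f = "restrict (q \<circ> \<phi>) (verts H)"
    have bf: "bij_betw ?f (verts H) {..<?N}"
      using bij_betw_trans[OF phi bq] by (simp add: bij_betw_cong[of "verts H" ?f "q \<circ> \<phi>"])
    then have f: "?f \<in> labelings H"
      by (auto simp: labelings_def dest: bij_betw_apply)
    have inv: "inv_into (verts H) ?f (q (\<kappa> u)) = inv_into (verts H) \<phi> (\<kappa> u)"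
      if "u \<in> verts G" for u
    proof (rule inv_into_f_eq)
      have ku: "\<kappa> u \<in> \<phi> ` verts H" using that kap phi by (auto simp: bij_betw_def)
      then show h: "inv_into (verts H) \<phi> (\<kappa> u) \<in> verts H" by (rule inv_into_into)
      show "inj_on ?f (verts H)" using bf by (rule bij_betw_imp_inj_on)
      show "?f (inv_into (verts H) \<phi> (\<kappa> u)) = q (\<kappa> u)"
        using h ku by (simp add: f_inv_into_f)
    qed
    have vs: "u \<in> verts G" "v \<in> verts G" if "u \<rightarrow>\<^bsub>G\<^esub> v" for u v
      using that wf by (auto simp: arcs_ends_def arc_to_ends_def wf_digraph_def)
    have "restrict (q \<circ> \<kappa>) (verts G) \<in> proper_colorings G H ?f"
      unfolding proper_colorings_def
    proof (intro CollectI conjI allI impI)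
      show "restrict (q \<circ> \<kappa>) (verts G) \<in> verts G \<rightarrow>\<^sub>E {..<?N}"
        using kap bq by (auto dest: bij_betw_apply)
      fix u v assume "u \<rightarrow>\<^bsub>G\<^esub> v"
      then show "inv_into (verts H) ?f (restrict (q \<circ> \<kappa>) (verts G) u) \<rightarrow>\<^bsub>H\<^esub>
          inv_into (verts H) ?f (restrict (q \<circ> \<kappa>) (verts G) v)"
        using ad[of u v] vs[of u v] inv[of u] inv[of v] by simp
    qed
    with f xe show ?thesis by simp
  qed
  have inverse: "?T q' (?T q x) = x" if x: "x \<in> ?S" and qq: "\<And>i. q' (q i) = i" for q q' x
  proof -
    obtain \<phi> \<kappa> where xe: "x = (\<phi>, \<kappa>)" by (cases x)
    have "\<phi> \<in> extensional (verts H)" "\<kappa> \<in> extensional (verts G)"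
      using x xe by (auto simp: labelings_def proper_colorings_def PiE_def)
    then show ?thesis
      using qq xe by (auto simp: fun_eq_iff restrict_def extensional_def)
  qed
  have pinv: "inv p permutes {..<?N}" "\<And>i. p (inv p i) = i" "\<And>i. inv p (p i) = i"
    using p by (auto simp: permutes_inv permutes_inverses)
  have cont: "content (verts G) (snd (?T p x)) = b \<longleftrightarrow> content (verts G) (snd x) = a" for x
  proof -
    obtain \<phi> \<kappa> where xe: "x = (\<phi>, \<kappa>)" by (cases x)
    have e: "{v \<in> verts G. restrict (p \<circ> \<kappa>) (verts G) v = p i} = {v \<in> verts G. \<kappa> v = i}" for i
      using pinv(3) by (auto dest: arg_cong[of _ _ "inv p"])
    have "content (verts G) (snd (?T p x)) = b \<longleftrightarrow>
        (\<forall>i. card {v \<in> verts G. restrict (p \<circ> \<kappa>) (verts G) v = p i} = Poly_Mapping.lookup b (p i))"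
      using pinv(2) fin xe
      by (auto simp: poly_mapping_eq_iff fun_eq_iff lookup_content) metis
    also have "\<dots> \<longleftrightarrow> content (verts G) (snd x) = a"
      unfolding e ab using fin xe by (auto simp: poly_mapping_eq_iff fun_eq_iff lookup_content)
    finally show ?thesis .
  qed
  show ?thesis
    unfolding lookup_w_poly[OF fin] case_prod_unfold
  proof (rule sum.reindex_bij_witness[of _ "?T (inv p)" "?T p"], goal_cases)
    case (1 x) then show ?case by (rule inverse) (rule pinv(3))
  next
    case (2 x) then show ?case by (rule mem[OF p])
  next
    case (3 x) then show ?case by (rule inverse) (rule pinv(2))
  next
    case (4 x) then show ?case by (rule mem[OF pinv(1)])
  next
    case (5 x) show ?case unfolding cont by (rule refl)
  qed
qed

lemma w_poly_nonzeroD: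
  assumes "finite (verts G)" "finite (verts H)" "Poly_Mapping.lookup (w_poly G H) a \<noteq> 0"
  shows "Poly_Mapping.keys a \<subseteq> {..<card (verts H)}" "sum_mset (shape a) = card (verts G)"
proof -
  obtain \<phi> \<kappa> where k: "\<kappa> \<in> proper_colorings G H \<phi>" and a: "content (verts G) \<kappa> = a"
    using assms(3) unfolding lookup_w_poly[OF assms(1,2)]
    by (auto elim!: sum.not_neutral_contains_not_neutral split: if_splits)
  have r: "\<kappa> v < card (verts H)" if "v \<in> verts G" for v
    using k that by (auto simp: proper_colorings_def)
  have keys: "Poly_Mapping.keys a = \<kappa> ` verts G"
    using assms(1) by (auto simp: a[symmetric] in_keys_iff lookup_content card_eq_0_iff)
  then show "Poly_Mapping.keys a \<subseteq> {..<card (verts H)}" using r by auto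
  have "Poly_Mapping.lookup a = (\<lambda>i. card {v \<in> verts G. \<kappa> v = i})"
    using lookup_content[OF assms(1), of \<kappa>] by (simp add: fun_eq_iff a)
  then have "sum_mset (shape a) = (\<Sum>i\<in>\<kappa> ` verts G. card {v \<in> verts G. \<kappa> v = i})"
    by (simp add: shape_def keys sum_unfold_sum_mset)
  also have "\<dots> = card (verts G)"
    using sum.image_gen[OF assms(1), of "\<lambda>_. 1::nat" \<kappa>] by simp
  finally show "sum_mset (shape a) = card (verts G)" .
qed

lemma shape_full:
  assumes "Poly_Mapping.keys a \<subseteq> {..<N}"
  shows "image_mset (Poly_Mapping.lookup a) (mset_set {..<N}) = shape a + replicate_mset (N - card (Poly_Mapping.keys a)) 0"
proof -
  have "mset_set {..<N} = mset_set (Poly_Mapping.keys a) + mset_set ({..<N} - Poly_Mapping.keys a)"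
    using assms by (subst mset_set_Union[symmetric]) (auto simp: Un_absorb1)
  moreover have "image_mset (Poly_Mapping.lookup a) (mset_set ({..<N} - Poly_Mapping.keys a)) =
      image_mset (\<lambda>_. 0) (mset_set ({..<N} - Poly_Mapping.keys a))"
    by (intro image_mset_cong) (auto simp: in_keys_iff)
  ultimately show ?thesis
    using assms by (simp add: shape_def image_mset_const_eq card_Diff_subset)
qed

lemma w_poly_symmetric:
  assumes "finite (verts G)" "finite (verts H)" "wf_digraph G"
    and k: "Poly_Mapping.keys a \<subseteq> {..<card (verts H)}" "Poly_Mapping.keys b \<subseteq> {..<card (verts H)}"
    and sh: "shape a = shape b"
  shows "Poly_Mapping.lookup (w_poly G H) a = Poly_Mapping.lookup (w_poly G H) b"
proof -
  let ?N = "card (verts H)"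
  have "card (Poly_Mapping.keys a) = card (Poly_Mapping.keys b)"
    using sh by (metis shape_def size_image_mset size_mset_set)
  then have "image_mset (Poly_Mapping.lookup a) (mset_set {..<?N}) = image_mset (Poly_Mapping.lookup b) (mset_set {..<?N})"
    using sh by (simp add: shape_full k)
  then obtain p where p: "p permutes {..<?N}" "\<And>i. i \<in> {..<?N} \<Longrightarrow> Poly_Mapping.lookup a i = Poly_Mapping.lookup b (p i)"
    by (rule image_mset_eq_implies_permutes[OF finite_lessThan]) blast
  have "Poly_Mapping.lookup b (p i) = Poly_Mapping.lookup a i" for i
  proof (cases "i < ?N")
    case False
    then have "p i = i" "i \<notin> Poly_Mapping.keys a" "i \<notin> Poly_Mapping.keys b"
      using p(1) k by (auto simp: permutes_def)
    then show ?thesis by (simp add: in_keys_iff)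
  qed (use p(2) in auto)
  then show ?thesis using w_poly_permute[OF assms(1-3) p(1)] by blast
qed

lemma lookup_expansion:
  assumes "nu \<in> partitions_of d N" "shape a = mset nu" "Poly_Mapping.keys a \<subseteq> {..<N}"
  shows "Poly_Mapping.lookup (\<Sum>mu\<in>partitions_of d N. Poly_Mapping.single 0 (c mu) * msym_poly N mu) a = c nu"
proof -
  have "Poly_Mapping.lookup (\<Sum>mu\<in>partitions_of d N. Poly_Mapping.single 0 (c mu) * msym_poly N mu) a =
      (\<Sum>mu\<in>partitions_of d N. if mu = nu then c mu else 0)"
    unfolding lookup_sum' lookup_const_mult lookup_msym_poly
    using assms partition_mset_inj[of _ nu] by (intro sum.cong) (auto simp: partitions_of_def)
  then show ?thesis using assms(1) by simp
qed

theorem w_poly_expansion: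
  assumes "graph G" "graph H"
  shows "w_poly G H = (\<Sum>mu\<in>partitions_of (card (verts G)) (card (verts H)).
           Poly_Mapping.single 0 (w_coeff G H mu) * msym_poly (card (verts H)) mu)"
    (is "_ = ?R")
proof (rule poly_mapping_eqI)
  fix a
  let ?d = "card (verts G)" and ?N = "card (verts H)"
  interpret G: graph G by fact
  interpret H: graph H by fact
  note fin = G.finite_verts H.finite_verts
  define nu where "nu = rev (sorted_list_of_multiset (shape a))"
  have nu: "is_partition nu" "mset nu = shape a"
    by (auto simp: nu_def is_partition_def sorted_wrt_rev shape_def in_keys_iff)
  show "Poly_Mapping.lookup (w_poly G H) a = Poly_Mapping.lookup ?R a"
  proof (cases "Poly_Mapping.keys a \<subseteq> {..<?N} \<and> sum_mset (shape a) = ?d")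
    case True
    have len: "length nu = card (Poly_Mapping.keys a)"
      using nu(2) by (metis shape_def size_image_mset size_mset size_mset_set)
    then have "length nu \<le> ?N"
      using True card_mono[of "{..<?N}" "Poly_Mapping.keys a"] by simp
    moreover have "sum_list nu = ?d"
      using True nu(2) by (metis sum_mset_sum_list)
    ultimately have mem: "nu \<in> partitions_of ?d ?N" using nu by (simp add: partitions_of_def)
    have "Poly_Mapping.lookup ?R a = w_coeff G H nu"
      using True nu by (intro lookup_expansion[OF mem]) auto
    also have "\<dots> = Poly_Mapping.lookup (w_poly G H) a"
      unfolding w_coeff_def
    proof (rule w_poly_symmetric[OF fin])
      have "0 \<notin> set nu" using nu by (simp add: is_partition_def)
      then show "Poly_Mapping.keys (Poly_Mapping.nth nu) \<subseteq> {..<?N}" "shape (Poly_Mapping.nth nu) = shape a"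
        using shape_nth[of nu] nu \<open>length nu \<le> ?N\<close> by auto
      show "wf_digraph G" by (rule G.wf_digraph)
    qed (use True in auto)
    finally show ?thesis ..
  next
    case False
    then have "Poly_Mapping.lookup (w_poly G H) a = 0" using w_poly_nonzeroD[OF fin] by blast
    moreover have "Poly_Mapping.lookup ?R a = 0"
      unfolding lookup_sum' lookup_const_mult lookup_msym_poly
      using False by (intro sum.neutral) (auto simp: partitions_of_def sum_mset_sum_list)
    ultimately show ?thesis by simp
  qed
qed

theorem w_poly_expansion_unique:
  assumes "w_poly G H = (\<Sum>mu\<in>partitions_of (card (verts G)) (card (verts H)).
             Poly_Mapping.single 0 (c mu) * msym_poly (card (verts H)) mu)"
    and "nu \<in> partitions_of (card (verts G)) (card (verts H))"
  shows "c nu = w_coeff G H nu"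
proof -
  have "0 \<notin> set nu" "length nu \<le> card (verts H)"
    using assms(2) by (auto simp: partitions_of_def is_partition_def)
  then show ?thesis
    unfolding w_coeff_def assms(1)
    using lookup_expansion[OF assms(2), of "Poly_Mapping.nth nu" c] shape_nth[of nu] by auto
qed

end

theory Submission
  imports Defs
begin

text \<open>
  A proper \<open>(K\<^sub>n, \<phi>)\<close>-coloring of \<open>K\<^sub>n\<close> is an injective map into \<open>n\<close> colors, so
  whatever \<open>\<phi>\<close> is, the \<open>n!\<close> proper colorings are the bijections onto the color set and each
  contributes the monomial \<open>x\<^sub>0 \<cdots> x\<^bsub>n-1\<^esub>\<close>. Hence \<open>X_sym K\<^sub>n K\<^sub>n\<close> is \<open>(n!)\<^sup>2\<close> times the
  elementary symmetric function of degree \<open>n\<close>.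
\<close>

text \<open>An injection between finite sets of equal size is onto. Describing labelings by
  injectivity alone makes them countable by the formula for injections and comparable with proper
  colorings.\<close>

lemma labelings_eq_inj:
  assumes "finite (verts H)"
  shows "labelings H = {f \<in> verts H \<rightarrow>\<^sub>E {..<card (verts H)}. inj_on f (verts H)}"
proof -
  have "f ` verts H = {..<card (verts H)}"
    if "f \<in> verts H \<rightarrow>\<^sub>E {..<card (verts H)}" "inj_on f (verts H)" for f
    using that by (intro card_subset_eq) (auto simp: card_image)
  then show ?thesis by (auto simp: labelings_def bij_betw_def)
qed

lemma card_labelings:
  assumes "finite (verts H)"
  shows "card (labelings H) = fact (card (verts H))"
  \<comment> \<open>The number of injections is a falling factorial; with domain and codomain of
    equal size it runs all the way down to 1.\<close>
  using card_inj_on_subset_funcset[OF assms, of "{..<card (verts H)}" "verts H"]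
  by (simp add: labelings_eq_inj[OF assms] fact_prod_rev)

text \<open>Adjacency in a complete graph is inequality of vertices, and the inverse of
  \<open>\<phi>\<close> is injective, so edges are preserved exactly when distinct vertices get
  distinct colors.\<close>

lemma proper_colorings_complete:
  assumes K: "complete_digraph n K" and phi: "\<phi> \<in> labelings K"
  shows "proper_colorings K K \<phi> = labelings K"
proof -
  interpret graph K using K by (simp add: complete_digraph_def)
  have n: "card (verts K) = n"
    and adj: "\<And>u v. u \<rightarrow>\<^bsub>K\<^esub> v \<longleftrightarrow> u \<in> verts K \<and> v \<in> verts K \<and> u \<noteq> v"
    using K by (auto simp: complete_digraph_def)
  have b: "bij_betw (inv_into (verts K) \<phi>) {..<n} (verts K)"
    using phi n by (auto simp: labelings_def intro: bij_betw_inv_into)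
  have "(\<forall>u v. u \<rightarrow>\<^bsub>K\<^esub> v \<longrightarrow>
       inv_into (verts K) \<phi> (\<kappa> u) \<rightarrow>\<^bsub>K\<^esub> inv_into (verts K) \<phi> (\<kappa> v)) \<longleftrightarrow>
     inj_on \<kappa> (verts K)" if k: "\<kappa> \<in> verts K \<rightarrow>\<^sub>E {..<n}" for \<kappa>
  proof -
    \<comment> \<open>The inverse labeling is known to be injective, with values in
      \<open>verts K\<close>, only on the color set, so the colors must first be located
      there.\<close>
    have "\<kappa> u \<in> {..<n}" if "u \<in> verts K" for u using k that by auto
    then show ?thesis
      unfolding adj inj_on_def
      using bij_betw_apply[OF b] inj_on_eq_iff[OF bij_betw_imp_inj_on[OF b]] by metis
  qed
  then show ?thesis
    unfolding proper_colorings_def labelings_eq_inj[OF finite_verts] n by blast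
qed

text \<open>Each color below \<open>card (verts H)\<close> has exactly one preimage and every other
  color has none, so the exponent vector does not depend on the labeling.\<close>

lemma content_labeling:
  assumes "finite (verts H)" "\<kappa> \<in> labelings H"
  shows "content (verts H) \<kappa> = Poly_Mapping.nth (replicate (card (verts H)) 1)"
proof (rule poly_mapping_eqI)
  fix i
  have b: "bij_betw \<kappa> (verts H) {..<card (verts H)}"
    using assms(2) by (simp add: labelings_def)
  have "card {v \<in> verts H. \<kappa> v = i} = (if i < card (verts H) then 1 else 0)"
  proof (cases "i < card (verts H)")
    case True
    then obtain u where u: "u \<in> verts H" "\<kappa> u = i"
      using b by (metis bij_betw_imp_surj_on imageE lessThan_iff)
    then have "{v \<in> verts H. \<kappa> v = i} = {u}"
      using bij_betw_imp_inj_on[OF b] by (auto dest: inj_onD)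
    then show ?thesis using True by simp
  next
    case False
    then have "{v \<in> verts H. \<kappa> v = i} = {}" using bij_betw_apply[OF b] by auto
    then show ?thesis using False by (simp only: card.empty if_False)
  qed
  then show "Poly_Mapping.lookup (content (verts H) \<kappa>) i =
      Poly_Mapping.lookup (Poly_Mapping.nth (replicate (card (verts H)) 1)) i"
    using assms(1) by (simp add: lookup_content nth_default_def)
qed

text \<open>All pairs of a labeling and a coloring yield the same monomial, so a coefficient counts
  either every pair or none.\<close>

lemma w_coeff_complete:
  assumes K: "complete_digraph n K" and mu: "mu \<in> partitions_of n n"
  shows "w_coeff K K mu = (if mu = replicate n 1 then (fact n)\<^sup>2 else 0)"
proof -
  interpret graph K using K by (simp add: complete_digraph_def)
  have n: "card (verts K) = n" using K by (simp add: complete_digraph_def)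
  have part: "is_partition mu" "is_partition (replicate n 1)"
    using mu by (auto simp: partitions_of_def is_partition_def sorted_wrt_iff_nth_less)
  \<comment> \<open>A partition is recovered from its exponent vector: \<open>shape\<close> returns
    the multiset of its parts, and sortedness fixes their order.\<close>
  have nth_eq: "Poly_Mapping.nth (replicate n 1) = Poly_Mapping.nth mu \<longleftrightarrow> mu = replicate n 1"
    using part shape_nth(1)[of mu] shape_nth(1)[of "replicate n 1"] partition_mset_inj[OF part]
    by (auto simp: is_partition_def)
  have "w_coeff K K mu = (\<Sum>(\<phi>, \<kappa>)\<in>Sigma (labelings K) (proper_colorings K K).
      if content (verts K) \<kappa> = Poly_Mapping.nth mu then 1 else 0)"
    unfolding w_coeff_def by (rule lookup_w_poly) simp_all
  also have "Sigma (labelings K) (proper_colorings K K) = labelings K \<times> labelings K"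
    by (rule Sigma_cong) (simp_all add: proper_colorings_complete[OF K])
  also have "(\<Sum>(\<phi>, \<kappa>)\<in>labelings K \<times> labelings K.
      if content (verts K) \<kappa> = Poly_Mapping.nth mu then 1 else 0) =
      (\<Sum>(\<phi>, \<kappa>)\<in>labelings K \<times> labelings K. if mu = replicate n 1 then 1 else 0 :: rat)"
    by (rule sum.cong) (auto simp: content_labeling n nth_eq simp del: One_nat_def)
  also have "\<dots> = (if mu = replicate n 1 then (fact n)\<^sup>2 else 0)"
    by (simp add: card_cartesian_product card_labelings n power2_eq_square)
  finally show ?thesis .
qed

lemma mscale_zero_left [simp]: "mscale 0 f = 0"
  by transfer simp

lemma mscale_one_left [simp]: "mscale 1 f = f"
  by transfer simp

lemma mscale_mscale: "mscale c (mscale d f) = mscale (c * d) f"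
  by transfer (simp add: mult.assoc)

lemma mscale_mult_mscale: "mscale c f * mscale d g = mscale (c * d) (f * g)"
  by transfer (simp add: fun_eq_iff sum_distrib_left case_prod_unfold ac_simps)

lemma prod_list_mscale:
  "(\<Prod>x\<leftarrow>xs. mscale (c x) (f x)) = mscale (\<Prod>x\<leftarrow>xs. c x) (\<Prod>x\<leftarrow>xs. f x)"
  by (induction xs) (simp_all add: mscale_mult_mscale)

text \<open>Only the partition of \<open>n\<close> into ones survives in the defining sum, and its
  monomial function is \<open>esym n\<close>.\<close>

lemma X_sym_complete:
  assumes "complete_digraph n K"
  shows "X_sym K K = mscale ((fact n)\<^sup>2) (esym n)"
proof -
  have n: "card (verts K) = n" using assms by (simp add: complete_digraph_def)
  have mem: "replicate n 1 \<in> partitions_of n n"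
    by (auto simp: partitions_of_def is_partition_def sorted_wrt_iff_nth_less sum_list_replicate)
  have "X_sym K K = (\<Sum>mu\<in>partitions_of n n.
      if mu = replicate n 1 then mscale ((fact n)\<^sup>2) (msym mu) else 0)"
    unfolding X_sym_def n by (rule sum.cong) (auto simp: w_coeff_complete[OF assms])
  also have "\<dots> = mscale ((fact n)\<^sup>2) (esym n)"
    using mem by (simp add: esym_def)
  finally show ?thesis .
qed

theorem corollary7p6:
  fixes lam :: "nat list" and Kgraph :: "nat \<Rightarrow> ('a, 'b) pre_digraph"
  assumes "is_partition lam"
    and "\<And>n. n \<in> set lam \<Longrightarrow> complete_digraph n (Kgraph n)"
  shows "esym_part lam =
    mscale (1 / (\<Prod>n\<leftarrow>lam. (fact n)\<^sup>2)) (\<Prod>n\<leftarrow>lam. X_sym (Kgraph n) (Kgraph n))"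
proof -
  have "map (\<lambda>n. X_sym (Kgraph n) (Kgraph n)) lam = map (\<lambda>n. mscale ((fact n)\<^sup>2) (esym n)) lam"
    using assms(2) by (intro map_cong) (simp_all add: X_sym_complete)
  then have "(\<Prod>n\<leftarrow>lam. X_sym (Kgraph n) (Kgraph n)) =
      mscale (\<Prod>n\<leftarrow>lam. (fact n)\<^sup>2) (esym_part lam)"
    by (simp only: prod_list_mscale esym_part_def)
  \<comment> \<open>Nonvanishing lets the reciprocal scalar cancel the collected one.\<close>
  moreover have "(\<Prod>n\<leftarrow>lam. (fact n)\<^sup>2) \<noteq> (0 :: rat)"
    by (auto simp: prod_list_zero_iff)
  ultimately show ?thesis by (simp add: mscale_mscale)
qed

end
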